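(* Let $\epsilon>0$, $\gamma\ge 1$, and let $1=v_-<v_+$ and $u_->u_+$ be real numbers. Then there exists a unique (up to a translation) travelling wave solution $(\mathbf u,\mathbf v)(t,x)=(u_\epsilon,v_\epsilon)(\xi)$, $\xi:=x-st$, of the system $$\partial_t v-\partial_x u=0,\qquad \partial_t u-\partial_x(\phi_\epsilon(v)\partial_x u)=0,$$ complemented with the far field condition $(\mathbf u,\mathbf v)\to(u_\pm,v_\pm)$ as $\xi\to\pm\infty$, where $s$ is the shock speed, which satisfies $$s=\frac{u_--u_+}{v_+-1}.$$ The profile $v_\epsilon$ is a smooth monotone increasing function connecting $1$ (at $-\infty$) to $v_+$ (at $+\infty$). By setting $v_\epsilon(0)=(1+v_+)/2$, one then has the following estimates. (i) In the congested region ($\xi<0$), $$1+\left(B-\frac{A_0}{\epsilon}\xi\right)^{-1/\gamma}\le v_\epsilon(\xi)\le 1+\left(B-\frac{A_1}{\epsilon}\xi\right)^{-1/\gamma},$$ where $A_0:=\frac{s(v_+-1)(v_++1)}{2}$, $A_1:=\frac{s(v_+-1)}{2}$ and $B:=\left(\frac{2}{v_+-1}\right)^{\gamma}$. (ii) In the free region ($\xi>0$), $$v_+-\frac{v_+-1}{2}\exp\left(-\frac{A_2}{\epsilon}\xi\right)\le v_\epsilon(\xi)\le v_+-\frac{v_+-1}{2}\exp\left(-\frac{A_3}{\epsilon}\xi\right),$$ where $A_2:=\frac{s(v_++1)(v_+-1)^{\gamma+1}}{2^{\gamma+2}\gamma}$ and $A_3:=\frac{s v_+(v_+-1)^{\gamma+1}}{\gamma}$.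 It follows that $v_\epsilon$ converges to the shock wave $v(\xi):=\mathbf 1_{\xi<0}+v_+\mathbf 1_{\xi>0}$ as $\epsilon\to0$, and it holds $$v_\epsilon(\xi)\le\left[1+\left(B-\frac{A_1}{\epsilon}\xi\right)^{-1/\gamma}\right]\mathbf 1_{\xi<0}+v_+\mathbf 1_{\xi\ge0}.$$
   Context: For $\epsilon>0$ and $\gamma\ge1$, $\phi_\epsilon(v):=\dfrac{\epsilon\gamma}{v(v-1)^{\gamma+1}}$ for $v>1$; the unknown $v$ is the specific volume (the inverse of the density) and $u$ is the velocity. A travelling wave solution is a solution depending on $(t,x)$ only through $\xi=x-st$ for some real $s$ (the shock speed). $\mathbf 1_A$ denotes the indicator function of $A$. *)

theory Defs
  imports "HOL-Analysis.Analysis"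
begin

definition phi :: "real \<Rightarrow> real \<Rightarrow> real \<Rightarrow> real" where
  "phi \<epsilon> \<gamma> v = \<epsilon> * \<gamma> / (v * (v - 1) powr (\<gamma> + 1))"

definition partial_t :: "(real \<Rightarrow> real \<Rightarrow> real) \<Rightarrow> real \<Rightarrow> real \<Rightarrow> real" where
  "partial_t w t x = deriv (\<lambda>\<tau>. w \<tau> x) t"

definition partial_x :: "(real \<Rightarrow> real \<Rightarrow> real) \<Rightarrow> real \<Rightarrow> real \<Rightarrow> real" where
  "partial_x w t x = deriv (\<lambda>y. w t y) x"

definition has_partial_t :: "(real \<Rightarrow> real \<Rightarrow> real) \<Rightarrow> real \<Rightarrow> real \<Rightarrow> bool" where
  "has_partial_t w t x \<longleftrightarrow> (\<lambda>\<tau>. w \<tau> x) differentiable (at t)"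

definition has_partial_x :: "(real \<Rightarrow> real \<Rightarrow> real) \<Rightarrow> real \<Rightarrow> real \<Rightarrow> bool" where
  "has_partial_x w t x \<longleftrightarrow> (\<lambda>y. w t y) differentiable (at x)"

definition flux :: "real \<Rightarrow> real \<Rightarrow> (real \<Rightarrow> real \<Rightarrow> real) \<Rightarrow> (real \<Rightarrow> real \<Rightarrow> real) \<Rightarrow> real \<Rightarrow> real \<Rightarrow> real" where
  "flux \<epsilon> \<gamma> u v t x = phi \<epsilon> \<gamma> (v t x) * partial_x u t x"

(* Pointwise (classical) solutions on all of R x R.  Only the derivatives that occur in the
   system are required to exist, so that uniqueness is asserted in the largest such class.
   The condition v > 1 is part of the notion because phi is only meaningful there. *)
definition solves_system ::
  "real \<Rightarrow> real \<Rightarrow> (real \<Rightarrow> real \<Rightarrow> real) \<Rightarrow> (real \<Rightarrow> real \<Rightarrow> real) \<Rightarrow> bool" where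
  "solves_system \<epsilon> \<gamma> u v \<longleftrightarrow>
     (\<forall>t x. v t x > 1 \<and>
        has_partial_t v t x \<and> has_partial_x u t x \<and>
        has_partial_t u t x \<and> has_partial_x (flux \<epsilon> \<gamma> u v) t x \<and>
        partial_t v t x - partial_x u t x = 0 \<and>
        partial_t u t x - partial_x (flux \<epsilon> \<gamma> u v) t x = 0)"

(* U and V are the profiles, as functions of xi = x - s t. *)
definition travelling_wave ::
  "real \<Rightarrow> real \<Rightarrow> real \<Rightarrow> (real \<Rightarrow> real) \<Rightarrow> (real \<Rightarrow> real) \<Rightarrow> bool" where
  "travelling_wave \<epsilon> \<gamma> s U V \<longleftrightarrow>
     solves_system \<epsilon> \<gamma> (\<lambda>t x. U (x - s * t)) (\<lambda>t x. V (x - s * t))"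

definition far_field ::
  "(real \<Rightarrow> real) \<Rightarrow> (real \<Rightarrow> real) \<Rightarrow> real \<Rightarrow> real \<Rightarrow> real \<Rightarrow> real \<Rightarrow> bool" where
  "far_field U V um vm up vp \<longleftrightarrow>
     (U \<longlongrightarrow> um) at_bot \<and> (V \<longlongrightarrow> vm) at_bot \<and>
     (U \<longlongrightarrow> up) at_top \<and> (V \<longlongrightarrow> vp) at_top"

definition smooth :: "(real \<Rightarrow> real) \<Rightarrow> bool" where
  "smooth f \<longleftrightarrow> (\<forall>n x. (deriv ^^ n) f differentiable (at x))"

definition shock_wave :: "real \<Rightarrow> real \<Rightarrow> real" where
  "shock_wave vp \<xi> = indicator {..<0} \<xi> + vp * indicator {0<..} \<xi>"

end

theory Submission
  imports Defs
begin

text \<open>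
  For a travelling wave of speed \<open>s\<close> the first equation reads \<open>U' = - s V'\<close>, so \<open>U + s V\<close> is
  constant, and the two far field limits of this constant give the value of \<open>s\<close>.  (If \<open>s = 0\<close>
  then \<open>U\<close> is constant, which contradicts \<open>um > up\<close>.)  Integrating the second equation once
  gives \<open>phi(V) V' = D - s V\<close>.  As \<open>\<xi> \<rightarrow> +\<infinity>\<close> the derivative \<open>V'\<close> then has a
  limit, which is \<open>0\<close> because \<open>V\<close> converges, so \<open>D = s vp\<close>.  The profile equation is therefore
  the scalar autonomous equation
  \<open>V' = s V (V - 1)^(\<gamma>+1) (vp - V) / (\<epsilon> \<gamma>)\<close>,
  whose right-hand side is positive between its zeros \<open>1\<close> and \<open>vp\<close>.

  Separation of variables (lemma \<open>heteroclinic_orbit\<close>) solves it: the travel time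
  \<open>G(v) = \<integral> dv / f(v)\<close> is an increasing bijection from \<open>(1, vp)\<close> to the real line, because
  \<open>f\<close> vanishes at least linearly at both ends.  Its inverse is a profile, and every other solution
  \<open>W\<close> with values in \<open>(1, vp)\<close> satisfies \<open>G(W(\<xi>)) = \<xi> + h\<close>, hence is a translate of it.  A wave
  that connects \<open>1\<close> to \<open>vp\<close> does stay in \<open>(1, vp)\<close>, because \<open>vp - V\<close> solves a linear homogeneous
  equation and so cannot change sign (lemma \<open>travelling_wave_profile\<close>).

  The estimates (lemmas \<open>congested_estimate\<close> and \<open>free_estimate\<close>) come from two substitutions.  In the congested region
  \<open>((V - 1)^(-\<gamma>))' = - (s / \<epsilon>) V (vp - V)\<close>, and in the free region
  \<open>(ln (vp - V))' = - s V (V - 1)^(\<gamma>+1) / (\<epsilon> \<gamma>)\<close>; both right-hand sides lie between constants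
  once \<open>V\<close> is known to lie to the left, respectively to the right, of the midpoint \<open>(1 + vp) / 2\<close>.
  For fixed \<open>\<xi>\<close> both bounds tend to \<open>1\<close>, respectively to \<open>vp\<close>, as \<open>\<epsilon> \<rightarrow> 0\<close>, which squeezes the
  profile to the shock wave.
\<close>

section \<open>Connecting orbits of scalar autonomous equations\<close>

text \<open>
  The lower bound for \<open>1 / f\<close> is the derivative of a multiple of the logistic travel time
  \<open>ln ((v - a) / (b - v))\<close>, which is unbounded in both directions; comparison with it makes the
  travel time of \<open>f\<close> unbounded too.
\<close>
lemma travel_time_bijection:
  fixes f :: "real \<Rightarrow> real" and a b c C :: real
  assumes c: "a < c" "c < b"
    and cont: "\<And>v. a < v \<Longrightarrow> v < b \<Longrightarrow> isCont f v"
    and pos: "\<And>v. a < v \<Longrightarrow> v < b \<Longrightarrow> 0 < f v"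
    and le: "\<And>v. a < v \<Longrightarrow> v < b \<Longrightarrow> f v \<le> C * (v - a) * (b - v)"
  shows "\<exists>G. G c = 0 \<and> (\<forall>v\<in>{a<..<b}. (G has_real_derivative 1 / f v) (at v)) \<and>
    strict_mono_on {a<..<b} G \<and> G ` {a<..<b} = UNIV"
proof -
  have "\<exists>F. \<forall>v::real. ereal a < ereal v \<longrightarrow> ereal v < ereal b
      \<longrightarrow> (F has_vector_derivative 1 / f v) (at v)"
    by (rule einterval_antiderivative) (use c cont pos in \<open>force intro!: continuous_intros\<close>)+
  then obtain F where F: "\<And>v. a < v \<Longrightarrow> v < b \<Longrightarrow> (F has_real_derivative 1 / f v) (at v)"
    by (auto simp: has_real_derivative_iff_has_vector_derivative)
  define G where "G v = F v - F c" for v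
  have G: "(G has_real_derivative 1 / f v) (at v)" if "a < v" "v < b" for v
    unfolding G_def using F[OF that] by (auto intro!: derivative_eq_intros)
  have mono: "G x < G y" if "a < x" "x < y" "y < b" for x y
  proof (rule DERIV_pos_imp_increasing[OF that(2)])
    fix z assume "x \<le> z" "z \<le> y"
    then show "\<exists>d. (G has_real_derivative d) (at z) \<and> d > 0"
      using G[of z] pos[of z] that by (intro exI[of _ "1 / f z"]) auto
  qed
  have C: "C > 0"
  proof -
    have "0 < C * ((c - a) * (b - c))" using pos[OF c] le[OF c] by (simp add: mult.assoc)
    then show ?thesis using c by (intro zero_less_mult_pos2[of C "(c - a) * (b - c)"]) auto
  qed
  define L where "L v = (ln (v - a) - ln (b - v)) / (C * (b - a))" for v
  have L: "(L has_real_derivative 1 / (C * (v - a) * (b - v))) (at v)" if "a < v" "v < b" for v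
  proof -
    have "((\<lambda>v. ln (v - a) - ln (b - v)) has_real_derivative 1 / (v - a) + 1 / (b - v)) (at v)"
      using that by (auto intro!: derivative_eq_intros)
    from DERIV_cdivide[OF this]
    have "(L has_real_derivative (1 / (v - a) + 1 / (b - v)) / (C * (b - a))) (at v)"
      by (simp add: L_def[abs_def])
    moreover have "1 / (v - a) + 1 / (b - v) = (b - a) / ((v - a) * (b - v))"
      using that by (simp add: field_simps)
    ultimately show ?thesis using that c C by (simp add: mult_ac)
  qed
  have GL: "G x - L x \<le> G y - L y" if "a < x" "x \<le> y" "y < b" for x y
  proof (rule DERIV_nonneg_imp_nondecreasing[OF that(2)])
    fix z assume z: "x \<le> z" "z \<le> y"
    have "1 / (C * (z - a) * (b - z)) \<le> 1 / f z"
      using pos[of z] le[of z] z that by (intro divide_left_mono) auto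
    moreover have "((\<lambda>v. G v - L v) has_real_derivative 1 / f z - 1 / (C * (z - a) * (b - z))) (at z)"
      using z that by (intro DERIV_diff G L) auto
    ultimately show "\<exists>d. ((\<lambda>v. G v - L v) has_real_derivative d) (at z) \<and> d \<ge> 0"
      using diff_ge_0_iff_ge by blast
  qed
  \<comment> \<open>The point where the logistic travel time equals \<open>y\<close>.\<close>
  define p where "p y = a + (b - a) / (1 + exp (- (C * (b - a) * y)))" for y
  have p: "a < p y" "p y < b" "L (p y) = y" for y
  proof -
    define e where "e = exp (- (C * (b - a) * y))"
    have e: "e > 0" "ln e = - (C * (b - a) * y)" by (auto simp: e_def)
    have p1: "p y - a = (b - a) / (1 + e)" by (simp add: p_def e_def)
    have p2: "b - p y = (b - a) * e / (1 + e)"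
      unfolding p_def e_def[symmetric] using e by (simp add: field_simps)
    have "p y - a > 0" "b - p y > 0" unfolding p1 p2 using e c by simp_all
    then show "a < p y" "p y < b" by simp_all
    have "ln (p y - a) - ln (b - p y) = C * (b - a) * y"
      unfolding p1 p2 using e c by (simp add: ln_div ln_mult)
    then show "L (p y) = y" using C c by (simp add: L_def)
  qed
  have onto: "\<exists>v\<in>{a<..<b}. G v = y" for y
  proof -
    \<comment> \<open>\<open>G - L\<close> is nondecreasing and equals \<open>- L c\<close> at \<open>c\<close>, so \<open>G \<le> L - L c\<close> to the left of \<open>c\<close>
      and \<open>G \<ge> L - L c\<close> to the right of it: it suffices to go to where \<open>L\<close> has passed \<open>y + L c\<close>.
      The \<open>min\<close> and \<open>max\<close> keep the two points on the correct sides of \<open>c\<close>.\<close>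
    define l where "l = p (min (L c) (y + L c))"
    define r where "r = p (max (L c) (y + L c))"
    have Gc: "G c = 0" by (simp add: G_def)
    have Lmono: "L x < L z" if "a < x" "x < z" "z < b" for x z
    proof (rule DERIV_pos_imp_increasing[OF that(2)])
      fix w assume "x \<le> w" "w \<le> z"
      then have w: "a < w" "w < b" using that by auto
      then have "1 / (C * (w - a) * (b - w)) > 0" using C by simp
      then show "\<exists>d. (L has_real_derivative d) (at w) \<and> d > 0" using L[OF w] by blast
    qed
    have l: "a < l" "l < b" "L l = min (L c) (y + L c)"
      and r: "a < r" "r < b" "L r = max (L c) (y + L c)"
      unfolding l_def r_def using p by auto
    have lc: "l \<le> c" using Lmono[of c l] l c by linarith
    have cr: "c \<le> r" using Lmono[of r c] r c by linarith
    have "G l \<le> y" using GL[OF l(1) lc c(2)] Gc l(3) by linarith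
    moreover have "y \<le> G r" using GL[OF c(1) cr r(2)] Gc r(3) by linarith
    moreover have "continuous_on {l..r} G"
      using DERIV_isCont[OF G] l r by (intro continuous_at_imp_continuous_on) auto
    ultimately obtain v where "l \<le> v" "v \<le> r" "G v = y"
      using IVT'[of G l y r] lc cr by auto
    then show ?thesis using l r by (intro bexI[of _ v]) auto
  qed
  have "G ` {a<..<b} = UNIV" using onto by (auto simp: image_iff) metis
  moreover have "strict_mono_on {a<..<b} G" using mono by (auto intro!: strict_mono_onI)
  moreover have "G c = 0" by (simp add: G_def)
  moreover have "\<forall>v\<in>{a<..<b}. (G has_real_derivative 1 / f v) (at v)" using G by simp
  ultimately show ?thesis by (intro exI[of _ G] conjI)
qed

text \<open>
  The orbit is the inverse of the travel time \<open>G\<close>.  Any other solution \<open>W\<close> in the interval has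
  \<open>(G \<circ> W)' = 1\<close>, so it runs through the same orbit with a time shift.
\<close>
lemma heteroclinic_orbit:
  fixes f :: "real \<Rightarrow> real" and a b c C :: real
  assumes c: "a < c" "c < b"
    and cont: "\<And>v. a < v \<Longrightarrow> v < b \<Longrightarrow> isCont f v"
    and pos: "\<And>v. a < v \<Longrightarrow> v < b \<Longrightarrow> 0 < f v"
    and le: "\<And>v. a < v \<Longrightarrow> v < b \<Longrightarrow> f v \<le> C * (v - a) * (b - v)"
  shows "\<exists>V. V 0 = c \<and> (\<forall>\<xi>. a < V \<xi> \<and> V \<xi> < b \<and> (V has_real_derivative f (V \<xi>)) (at \<xi>)) \<and>
    strict_mono V \<and> (V \<longlongrightarrow> a) at_bot \<and> (V \<longlongrightarrow> b) at_top \<and>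
    (\<forall>W. (\<forall>\<xi>. a < W \<xi> \<and> W \<xi> < b \<and> (W has_real_derivative f (W \<xi>)) (at \<xi>)) \<longrightarrow>
      (\<exists>h. \<forall>\<xi>. W \<xi> = V (\<xi> + h)))"
proof -
  obtain G where Gc: "G c = 0"
    and G_ball: "\<forall>v\<in>{a<..<b}. (G has_real_derivative 1 / f v) (at v)"
    and sm: "strict_mono_on {a<..<b} G" and onto: "G ` {a<..<b} = UNIV"
    using travel_time_bijection[OF c cont pos le] by blast
  have G: "(G has_real_derivative 1 / f v) (at v)" if "a < v" "v < b" for v
    using G_ball that by simp
  have inj: "inj_on G {a<..<b}" using sm by (rule strict_mono_on_imp_inj_on)
  define V where "V = the_inv_into {a<..<b} G"
  have VG: "V (G v) = v" if "a < v" "v < b" for v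
    unfolding V_def using the_inv_into_f_f[OF inj] that by simp
  have GV: "G (V \<xi>) = \<xi>" for \<xi>
    unfolding V_def using f_the_inv_into_f[OF inj] onto by simp
  have Vab: "a < V \<xi>" "V \<xi> < b" for \<xi>
    using the_inv_into_into[OF inj, of \<xi> "{a<..<b}"] onto by (auto simp: V_def)
  have V_mono: "strict_mono V"
  proof (rule strict_monoI)
    fix x y :: real assume "x < y"
    then have "\<not> G (V y) \<le> G (V x)" by (simp add: GV)
    then show "V x < V y"
      using strict_mono_on_leD[OF sm, of "V y" "V x"] Vab by force
  qed
  have V_range: "range V = {a<..<b}"
  proof
    show "{a<..<b} \<subseteq> range V" using VG by (metis greaterThanLessThan_iff rangeI subsetI)
  qed (use Vab in auto)
  have "continuous_on UNIV V"
    using V_mono by (intro continuous_onI_mono) (auto simp: V_range strict_mono_less_eq)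
  then have V_cont: "isCont V \<xi>" for \<xi> by (simp add: continuous_on_eq_continuous_at)
  have V_ode: "(V has_real_derivative f (V \<xi>)) (at \<xi>)" for \<xi>
  proof -
    have "(V has_real_derivative inverse (1 / f (V \<xi>))) (at \<xi>)"
      by (rule DERIV_inverse_function[where f = G and a = "\<xi> - 1" and b = "\<xi> + 1"])
        (use G[OF Vab] pos[OF Vab, of \<xi>] GV V_cont in auto)
    then show ?thesis by simp
  qed
  have bot: "(V \<longlongrightarrow> a) at_bot"
  proof (rule order_tendstoI)
    fix y assume "a < y"
    then have y: "a < min y c" "min y c < b" using c by auto
    show "\<forall>\<^sub>F x in at_bot. V x < y"
      using eventually_gt_at_bot[of "G (min y c)"]
    proof eventually_elim
      case (elim x)
      then have "V x < V (G (min y c))" using V_mono by (simp add: strict_mono_less)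
      then show ?case by (simp add: VG[OF y])
    qed
  qed (use Vab in \<open>auto intro!: always_eventually intro: less_trans\<close>)
  have top: "(V \<longlongrightarrow> b) at_top"
  proof (rule order_tendstoI)
    fix y assume "y < b"
    then have y: "a < max y c" "max y c < b" using c by auto
    show "\<forall>\<^sub>F x in at_top. y < V x"
      using eventually_gt_at_top[of "G (max y c)"]
    proof eventually_elim
      case (elim x)
      then have "V (G (max y c)) < V x" using V_mono by (simp add: strict_mono_less)
      then show ?case by (simp add: VG[OF y])
    qed
  qed (use Vab in \<open>auto intro!: always_eventually intro: less_trans\<close>)
  have uniq: "\<exists>h. \<forall>\<xi>. W \<xi> = V (\<xi> + h)"
    if Wa: "\<And>\<xi>. a < W \<xi>" and Wb: "\<And>\<xi>. W \<xi> < b"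
      and W: "\<And>\<xi>. (W has_real_derivative f (W \<xi>)) (at \<xi>)" for W
  proof -
    have const: "((\<lambda>\<xi>. G (W \<xi>) - \<xi>) has_real_derivative 0) (at \<xi>)" for \<xi>
      using DERIV_diff[OF DERIV_chain2[OF G[OF Wa Wb] W] DERIV_ident, of \<xi>] pos[OF Wa Wb, of \<xi>]
      by simp
    have "W \<xi> = V (\<xi> + G (W 0))" for \<xi>
    proof -
      from const have "G (W \<xi>) - \<xi> = G (W 0) - 0" by (rule DERIV_isconst_all[rule_format])
      then have "G (W \<xi>) = \<xi> + G (W 0)" by linarith
      then show ?thesis using VG[OF Wa Wb, of \<xi>] by simp
    qed
    then show ?thesis by blast
  qed
  have "V 0 = c" using VG[OF c] Gc by simp
  moreover have "\<forall>\<xi>. a < V \<xi> \<and> V \<xi> < b \<and> (V has_real_derivative f (V \<xi>)) (at \<xi>)"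
    using Vab V_ode by simp
  moreover have "\<forall>W. (\<forall>\<xi>. a < W \<xi> \<and> W \<xi> < b \<and> (W has_real_derivative f (W \<xi>)) (at \<xi>)) \<longrightarrow>
      (\<exists>h. \<forall>\<xi>. W \<xi> = V (\<xi> + h))"
    using uniq by simp
  ultimately show ?thesis using V_mono bot top by (intro exI[of _ V] conjI)
qed

section \<open>Smoothness of solutions\<close>

text \<open>
  The right-hand side of the profile equation belongs to an algebra of functions on \<open>(1, \<infinity>)\<close> that
  is closed under differentiation.  All derivatives of a solution are then functions of the solution
  itself, taken from this algebra.
\<close>
inductive powr_polynomial :: "(real \<Rightarrow> real) \<Rightarrow> bool" where
  const: "powr_polynomial (\<lambda>_. c)"
| ident: "powr_polynomial (\<lambda>v. v)"
| powr: "powr_polynomial (\<lambda>v. (v - 1) powr p)"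
| add: "powr_polynomial f \<Longrightarrow> powr_polynomial g \<Longrightarrow> powr_polynomial (\<lambda>v. f v + g v)"
| mult: "powr_polynomial f \<Longrightarrow> powr_polynomial g \<Longrightarrow> powr_polynomial (\<lambda>v. f v * g v)"

lemma powr_polynomial_derivative:
  assumes "powr_polynomial f"
  shows "\<exists>g. powr_polynomial g \<and> (\<forall>v>1. (f has_real_derivative g v) (at v))"
  using assms
proof induction
  case (const c)
  show ?case by (intro exI[of _ "\<lambda>_. 0"]) (auto intro: powr_polynomial.const)
next
  case ident
  show ?case by (intro exI[of _ "\<lambda>_. 1"]) (auto intro: powr_polynomial.const)
next
  case (powr p)
  have "((\<lambda>v. (v - 1) powr p) has_real_derivative p * (v - 1) powr (p - 1)) (at v)"
    if "v > 1" for v :: real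
    using that by (auto intro!: derivative_eq_intros)
  then show ?case
    by (intro exI[of _ "\<lambda>v. p * (v - 1) powr (p - 1)"]) (auto intro: powr_polynomial.intros)
next
  case (add f g)
  then obtain f' g' where "powr_polynomial f'" "powr_polynomial g'"
    "\<forall>v>1. (f has_real_derivative f' v) (at v)" "\<forall>v>1. (g has_real_derivative g' v) (at v)"
    by blast
  then show ?case
    by (intro exI[of _ "\<lambda>v. f' v + g' v"])
      (auto intro: powr_polynomial.intros intro!: derivative_intros)
next
  case (mult f g)
  then obtain f' g' where "powr_polynomial f'" "powr_polynomial g'"
    "\<forall>v>1. (f has_real_derivative f' v) (at v)" "\<forall>v>1. (g has_real_derivative g' v) (at v)"
    by blast
  then show ?case using mult.hyps
    by (intro exI[of _ "\<lambda>v. f' v * g v + g' v * f v"])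
      (auto intro: powr_polynomial.intros intro!: DERIV_mult)
qed

lemma smooth_autonomous_solution:
  assumes f: "powr_polynomial f" and V1: "\<And>\<xi>. V \<xi> > 1"
    and V: "\<And>\<xi>. (V has_real_derivative f (V \<xi>)) (at \<xi>)"
  shows "smooth V"
proof -
  have deriv_comp: "((\<lambda>\<xi>. p (V \<xi>)) has_real_derivative q (V \<xi>) * f (V \<xi>)) (at \<xi>)"
    if "\<forall>v>1. (p has_real_derivative q v) (at v)" for p q \<xi>
    using DERIV_chain2[OF _ V] that V1 by blast
  have rep: "\<exists>p. powr_polynomial p \<and> (deriv ^^ n) V = (\<lambda>\<xi>. p (V \<xi>))" for n
  proof (induction n)
    case 0
    show ?case by (intro exI[of _ "\<lambda>v. v"]) (auto intro: powr_polynomial.intros)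
  next
    case (Suc n)
    then obtain p where p: "powr_polynomial p" "(deriv ^^ n) V = (\<lambda>\<xi>. p (V \<xi>))" by blast
    obtain q where q: "powr_polynomial q" "\<forall>v>1. (p has_real_derivative q v) (at v)"
      using powr_polynomial_derivative[OF p(1)] by blast
    have "(deriv ^^ Suc n) V = (\<lambda>\<xi>. q (V \<xi>) * f (V \<xi>))"
      using DERIV_imp_deriv[OF deriv_comp[OF q(2)]] by (auto simp: p(2))
    then show ?case using q f by (intro exI[of _ "\<lambda>v. q v * f v"]) (auto intro: powr_polynomial.intros)
  qed
  show ?thesis
    unfolding smooth_def
  proof (intro allI)
    fix n \<xi>
    obtain p where p: "powr_polynomial p" "(deriv ^^ n) V = (\<lambda>\<xi>. p (V \<xi>))" using rep by blast
    obtain q where q: "\<forall>v>1. (p has_real_derivative q v) (at v)"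
      using powr_polynomial_derivative[OF p(1)] by blast
    show "(deriv ^^ n) V differentiable (at \<xi>)"
      using deriv_comp[OF q, of \<xi>] unfolding p(2) real_differentiable_def by blast
  qed
qed

section \<open>Reduction of travelling waves to the profile equation\<close>

definition profile_rhs :: "real \<Rightarrow> real \<Rightarrow> real \<Rightarrow> real \<Rightarrow> real \<Rightarrow> real" where
  "profile_rhs \<epsilon> \<gamma> s vp v = s / (\<epsilon> * \<gamma>) * v * (v - 1) powr (\<gamma> + 1) * (vp - v)"

lemma phi_pos: "\<epsilon> > 0 \<Longrightarrow> \<gamma> \<ge> 1 \<Longrightarrow> v > 1 \<Longrightarrow> phi \<epsilon> \<gamma> v > 0"
  by (simp add: phi_def)

lemma phi_times_profile_rhs:
  "\<epsilon> > 0 \<Longrightarrow> \<gamma> \<ge> 1 \<Longrightarrow> v > 1 \<Longrightarrow> phi \<epsilon> \<gamma> v * profile_rhs \<epsilon> \<gamma> s vp v = s * (vp - v)"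
  by (simp add: phi_def profile_rhs_def)

lemma profile_rhs_eqI:
  assumes "\<epsilon> > 0" "\<gamma> \<ge> 1" "v > 1" "phi \<epsilon> \<gamma> v * w = s * (vp - v)"
  shows "w = profile_rhs \<epsilon> \<gamma> s vp v"
  using assms phi_pos[OF assms(1-3)] phi_times_profile_rhs[OF assms(1-3), of s vp]
  by (metis less_irrefl mult_left_cancel)

text \<open>
  Freezing \<open>t = 0\<close> recovers the profile from the wave; for \<open>V\<close>, of which the system only requires
  the time derivative, this needs \<open>s \<noteq> 0\<close>.
\<close>
lemma travelling_wave_iff:
  assumes s: "s \<noteq> 0"
  shows "travelling_wave \<epsilon> \<gamma> s U V \<longleftrightarrow>
    (\<exists>V'. \<forall>\<xi>. V \<xi> > 1 \<and> (V has_real_derivative V' \<xi>) (at \<xi>) \<and>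
      (U has_real_derivative - s * V' \<xi>) (at \<xi>) \<and>
      ((\<lambda>y. phi \<epsilon> \<gamma> (V y) * (- s * V' y)) has_real_derivative s\<^sup>2 * V' \<xi>) (at \<xi>))"
    (is "_ \<longleftrightarrow> (\<exists>V'. ?wave V')")
proof -
  have dt: "((\<lambda>\<tau>. f (x - s * \<tau>)) has_real_derivative - s * d) (at t)"
    if "(f has_real_derivative d) (at (x - s * t))" for f d t x
  proof -
    have "((\<lambda>\<tau>. f (x - s * \<tau>)) has_real_derivative d * (- s)) (at t)"
      using that by (rule DERIV_chain2) (auto intro!: derivative_eq_intros)
    then show ?thesis by (simp add: mult.commute)
  qed
  have dx: "((\<lambda>y. f (y - s * t)) has_real_derivative d) (at x)"
    if "(f has_real_derivative d) (at (x - s * t))" for f d t x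
  proof -
    have "((\<lambda>y. f (y - s * t)) has_real_derivative d * 1) (at x)"
      using that by (rule DERIV_chain2) (auto intro!: derivative_eq_intros)
    then show ?thesis by simp
  qed
  show ?thesis
  proof
    assume tw: "travelling_wave \<epsilon> \<gamma> s U V"
    let ?F = "\<lambda>y. phi \<epsilon> \<gamma> (V y) * deriv U y"
    have flux0: "flux \<epsilon> \<gamma> (\<lambda>t x. U (x - s * t)) (\<lambda>t x. V (x - s * t)) 0 y = ?F y" for y
      by (simp add: flux_def partial_x_def)
    note sys = tw[unfolded travelling_wave_def solves_system_def, rule_format, of _ 0]
    have V1: "V x > 1" for x using sys[of x] by simp
    have U: "(U has_real_derivative deriv U x) (at x)" for x
      using sys[of x] by (simp add: has_partial_x_def DERIV_deriv_iff_real_differentiable)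
    have F: "(?F has_real_derivative deriv ?F x) (at x)" for x
      using sys[of x] by (simp add: has_partial_x_def flux0 DERIV_deriv_iff_real_differentiable)
    have V: "(V has_real_derivative deriv V x) (at x)" for x
    proof -
      have "(\<lambda>\<tau>. V (x - s * \<tau>)) differentiable (at ((x - x) / s))"
        using sys[of x] by (simp add: has_partial_t_def)
      moreover have "(\<lambda>y. (x - y) / s) differentiable (at x)"
        using s by (auto intro!: derivative_intros)
      ultimately have "((\<lambda>\<tau>. V (x - s * \<tau>)) \<circ> (\<lambda>y. (x - y) / s)) differentiable (at x)"
        by (intro differentiable_chain_at)
      then show ?thesis using s by (simp add: o_def DERIV_deriv_iff_real_differentiable)
    qed
    have U': "deriv U x = - s * deriv V x" for x
      using sys[of x] DERIV_imp_deriv[OF dt[of V "deriv V x" x 0]] V[of x]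
      by (simp add: partial_t_def partial_x_def)
    have "deriv ?F x = - s * deriv U x" for x
      using sys[of x] DERIV_imp_deriv[OF dt[of U "deriv U x" x 0]] U[of x]
      by (simp add: partial_t_def partial_x_def[of "flux _ _ _ _"] flux0)
    then have F': "deriv ?F x = s\<^sup>2 * deriv V x" for x
      by (simp add: U' power2_eq_square)
    have "?wave (deriv V)"
      using V1 V U[unfolded U'] F[unfolded F', unfolded U'] by blast
    then show "\<exists>V'. ?wave V'" by blast
  next
    assume "\<exists>V'. ?wave V'"
    then obtain V' where V1: "\<And>\<xi>. V \<xi> > 1"
      and V: "\<And>\<xi>. (V has_real_derivative V' \<xi>) (at \<xi>)"
      and U: "\<And>\<xi>. (U has_real_derivative - s * V' \<xi>) (at \<xi>)"
      and F: "\<And>\<xi>. ((\<lambda>y. phi \<epsilon> \<gamma> (V y) * (- s * V' y)) has_real_derivative s\<^sup>2 * V' \<xi>) (at \<xi>)"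
      by blast
    have flux: "flux \<epsilon> \<gamma> (\<lambda>t x. U (x - s * t)) (\<lambda>t x. V (x - s * t)) t
        = (\<lambda>y. phi \<epsilon> \<gamma> (V (y - s * t)) * (- s * V' (y - s * t)))" for t
      unfolding flux_def partial_x_def using DERIV_imp_deriv[OF dx[OF U]] by simp
    show "travelling_wave \<epsilon> \<gamma> s U V"
      unfolding travelling_wave_def solves_system_def has_partial_t_def has_partial_x_def
        partial_t_def partial_x_def flux
    proof (intro allI conjI)
      fix t x
      show "1 < V (x - s * t)" by (rule V1)
      show "(\<lambda>\<tau>. V (x - s * \<tau>)) differentiable (at t)"
        "(\<lambda>y. U (y - s * t)) differentiable (at x)"
        "(\<lambda>\<tau>. U (x - s * \<tau>)) differentiable (at t)"
        "(\<lambda>y. phi \<epsilon> \<gamma> (V (y - s * t)) * (- s * V' (y - s * t))) differentiable (at x)"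
        using dt[OF V] dx[OF U] dt[OF U] dx[OF F] unfolding real_differentiable_def by blast+
      show "deriv (\<lambda>\<tau>. V (x - s * \<tau>)) t - deriv (\<lambda>y. U (y - s * t)) x = 0"
        unfolding DERIV_imp_deriv[OF dt[OF V]] DERIV_imp_deriv[OF dx[OF U]] by simp
      show "deriv (\<lambda>\<tau>. U (x - s * \<tau>)) t
          - deriv (\<lambda>y. phi \<epsilon> \<gamma> (V (y - s * t)) * (- s * V' (y - s * t))) x = 0"
        unfolding DERIV_imp_deriv[OF dt[OF U]] DERIV_imp_deriv[OF dx[OF F]]
        by (simp add: power2_eq_square)
    qed
  qed
qed

text \<open>
  By the mean value theorem, \<open>f(x + 1) - f(x)\<close> is a value of \<open>f'\<close> beyond \<open>x\<close>; the difference
  tends to \<open>0\<close> and the value to \<open>m\<close>.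
\<close>
lemma convergent_derivative_limit_zero:
  fixes f :: "real \<Rightarrow> real"
  assumes f: "\<And>x. (f has_real_derivative f' x) (at x)"
    and lim: "(f \<longlongrightarrow> l) at_top" "(f' \<longlongrightarrow> m) at_top"
  shows "m = 0"
proof -
  have "\<exists>c. x < c \<and> f (x + 1) - f x = f' c" for x
    using MVT2[of x "x + 1" f f'] f by auto
  then obtain c where c: "\<And>x. x < c x" "\<And>x. f (x + 1) - f x = f' (c x)" by metis
  have "filterlim c at_top at_top"
    using c(1) by (intro filterlim_at_top_mono[OF filterlim_ident]) (auto intro!: always_eventually less_imp_le)
  then have "((\<lambda>x. f' (c x)) \<longlongrightarrow> m) at_top" using lim(2) by (rule filterlim_compose[rotated])
  moreover have "((\<lambda>x. f (x + 1) - f x) \<longlongrightarrow> l - l) at_top"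
    by (intro tendsto_diff lim(1) filterlim_compose[OF lim(1)]
        filterlim_tendsto_add_at_top[OF tendsto_const filterlim_ident, of 1, simplified add.commute])
  ultimately show ?thesis using tendsto_unique[OF trivial_limit_at_top_linorder] by (auto simp: c(2))
qed

text \<open>The product of \<open>W\<close> with the integrating factor \<open>exp (\<integral> g)\<close> is constant.\<close>
lemma linear_homogeneous_positive:
  fixes W g :: "real \<Rightarrow> real"
  assumes W: "\<And>x. (W has_real_derivative - g x * W x) (at x)"
    and g: "\<And>x. isCont g x" and pos: "W x0 > 0"
  shows "W x > 0"
proof -
  have "\<exists>H. \<forall>x::real. -\<infinity> < ereal x \<longrightarrow> ereal x < \<infinity> \<longrightarrow> (H has_vector_derivative g x) (at x)"
    by (rule einterval_antiderivative) (use g in auto)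
  then obtain H where H: "\<And>x. (H has_real_derivative g x) (at x)"
    by (auto simp: has_real_derivative_iff_has_vector_derivative)
  have "((\<lambda>x. W x * exp (H x)) has_real_derivative 0) (at x)" for x
    using W H by (auto intro!: derivative_eq_intros)
  then have "W x * exp (H x) = W x0 * exp (H x0)" by (rule DERIV_isconst_all[rule_format])
  then show ?thesis using pos by (metis exp_gt_zero mult_pos_pos zero_less_mult_pos2)
qed

text \<open>
  Conservation of \<open>U + s V\<close>, read off at both ends, is the jump condition for the speed.
\<close>
lemma travelling_wave_speed:
  assumes vp: "1 < vp" and um: "um > up"
    and tw: "travelling_wave \<epsilon> \<gamma> s U V" and ff: "far_field U V um 1 up vp"
  shows "s = (um - up) / (vp - 1)" and "U \<xi> = um + s - s * V \<xi>"
proof -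
  have lim: "(U \<longlongrightarrow> um) at_bot" "(V \<longlongrightarrow> 1) at_bot" "(U \<longlongrightarrow> up) at_top" "(V \<longlongrightarrow> vp) at_top"
    using ff by (auto simp: far_field_def)
  have s: "s \<noteq> 0"
  proof
    assume "s = 0"
    with tw[unfolded travelling_wave_def solves_system_def, rule_format, of _ 0]
    have "U differentiable (at x)" "deriv U x = 0" for x
      by (simp_all add: has_partial_x_def partial_t_def partial_x_def)
    then have "\<forall>x. (U has_real_derivative 0) (at x)"
      by (metis DERIV_deriv_iff_real_differentiable)
    then have "U = (\<lambda>_. U 0)" using DERIV_isconst_all by blast
    then obtain k where k: "U = (\<lambda>_. k)" by blast
    then show False using lim(1,3) um by (simp add: tendsto_const_iff)
  qed
  from tw[unfolded travelling_wave_iff[OF s]] obtain V'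
    where V: "\<And>\<xi>. (V has_real_derivative V' \<xi>) (at \<xi>)"
      and U: "\<And>\<xi>. (U has_real_derivative - s * V' \<xi>) (at \<xi>)" by blast
  have "((\<lambda>\<xi>. U \<xi> + s * V \<xi>) has_real_derivative 0) (at \<xi>)" for \<xi>
    using U V by (auto intro!: derivative_eq_intros)
  then have "U \<xi> + s * V \<xi> = U 0 + s * V 0" for \<xi> by (rule DERIV_isconst_all[rule_format])
  then obtain K where K: "\<And>\<xi>. U \<xi> + s * V \<xi> = K" by blast
  have "((\<lambda>\<xi>. U \<xi> + s * V \<xi>) \<longlongrightarrow> um + s * 1) at_bot"
    "((\<lambda>\<xi>. U \<xi> + s * V \<xi>) \<longlongrightarrow> up + s * vp) at_top"
    by (intro tendsto_intros lim)+
  then have "K = um + s" "K = up + s * vp" by (simp_all add: K tendsto_const_iff)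
  then show "s = (um - up) / (vp - 1)" "U \<xi> = um + s - s * V \<xi>"
    using vp K[of \<xi>] by (auto simp: field_simps)
qed

text \<open>
  The upper bound \<open>V < vp\<close> is a sign statement: by the profile equation \<open>vp - V\<close> solves a linear
  homogeneous equation, and it is positive near \<open>-\<infinity>\<close>, where \<open>V\<close> tends to \<open>1\<close>.
\<close>
lemma travelling_wave_profile:
  assumes \<epsilon>: "\<epsilon> > 0" and \<gamma>: "\<gamma> \<ge> 1" and vp: "1 < vp" and um: "um > up"
    and tw: "travelling_wave \<epsilon> \<gamma> s U V" and ff: "far_field U V um 1 up vp"
  shows "1 < V \<xi>" "V \<xi> < vp" "(V has_real_derivative profile_rhs \<epsilon> \<gamma> s vp (V \<xi>)) (at \<xi>)"
proof -
  have lim: "(V \<longlongrightarrow> 1) at_bot" "(V \<longlongrightarrow> vp) at_top"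
    using ff by (auto simp: far_field_def)
  have s: "s \<noteq> 0" using travelling_wave_speed(1)[OF vp um tw ff] vp um by simp
  from tw[unfolded travelling_wave_iff[OF s]] obtain V'
    where V1: "\<And>\<xi>. V \<xi> > 1" and V: "\<And>\<xi>. (V has_real_derivative V' \<xi>) (at \<xi>)"
      and F: "\<And>\<xi>. ((\<lambda>y. phi \<epsilon> \<gamma> (V y) * (- s * V' y)) has_real_derivative s\<^sup>2 * V' \<xi>) (at \<xi>)"
    by blast
  have "((\<lambda>y. phi \<epsilon> \<gamma> (V y) * (- s * V' y) - s\<^sup>2 * V y) has_real_derivative 0) (at \<xi>)" for \<xi>
    using DERIV_diff[OF F DERIV_cmult[OF V, of "s\<^sup>2"], of \<xi>] by simp
  then have "phi \<epsilon> \<gamma> (V \<xi>) * (- s * V' \<xi>) - s\<^sup>2 * V \<xi>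
      = phi \<epsilon> \<gamma> (V 0) * (- s * V' 0) - s\<^sup>2 * V 0" for \<xi>
    by (rule DERIV_isconst_all[rule_format])
  then obtain K where K: "\<And>\<xi>. phi \<epsilon> \<gamma> (V \<xi>) * (- s * V' \<xi>) - s\<^sup>2 * V \<xi> = K" by blast
  define D where "D = - K / s"
  have D: "phi \<epsilon> \<gamma> (V \<xi>) * V' \<xi> = D - s * V \<xi>" for \<xi>
    using K[of \<xi>] s by (simp add: D_def field_simps power2_eq_square)
  \<comment> \<open>The integrated equation expresses \<open>V'\<close> through \<open>V\<close> alone, so \<open>V'\<close> inherits a limit at \<open>+\<infinity>\<close>;
    that this limit is \<open>0\<close> fixes the constant \<open>D\<close>.\<close>
  have V'_eq: "V' = (\<lambda>\<xi>. (D - s * V \<xi>) / phi \<epsilon> \<gamma> (V \<xi>))"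
  proof
    show "V' \<xi> = (D - s * V \<xi>) / phi \<epsilon> \<gamma> (V \<xi>)" for \<xi>
      using D[of \<xi>] phi_pos[OF \<epsilon> \<gamma> V1, of \<xi>] by (simp add: eq_divide_eq mult.commute)
  qed
  have "(V' \<longlongrightarrow> (D - s * vp) / phi \<epsilon> \<gamma> vp) at_top"
    unfolding V'_eq phi_def using \<epsilon> \<gamma> vp by (intro tendsto_intros lim) auto
  then have "(D - s * vp) / phi \<epsilon> \<gamma> vp = 0"
    using convergent_derivative_limit_zero[OF V lim(2)] by blast
  then have "D = s * vp" using phi_pos[OF \<epsilon> \<gamma> vp] by simp
  then have V'_rhs: "V' \<xi> = profile_rhs \<epsilon> \<gamma> s vp (V \<xi>)" for \<xi>
    using D[of \<xi>] by (intro profile_rhs_eqI[OF \<epsilon> \<gamma> V1]) (simp add: algebra_simps)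
  show "1 < V \<xi>" "(V has_real_derivative profile_rhs \<epsilon> \<gamma> s vp (V \<xi>)) (at \<xi>)"
    using V1 V V'_rhs by simp_all
  define g where "g \<xi> = s / (\<epsilon> * \<gamma>) * V \<xi> * (V \<xi> - 1) powr (\<gamma> + 1)" for \<xi>
  have "((\<lambda>x. vp - V x) has_real_derivative - g x * (vp - V x)) (at x)" for x
    using DERIV_diff[OF DERIV_const V, of vp x] by (simp add: V'_rhs g_def profile_rhs_def)
  moreover have "isCont g x" for x
  proof -
    have "V x - 1 \<noteq> 0" using V1[of x] by simp
    then show ?thesis unfolding g_def using DERIV_isCont[OF V] by (intro continuous_intros) auto
  qed
  moreover obtain x0 where "vp - V x0 > 0"
  proof -
    have "eventually (\<lambda>x. V x < vp) at_bot" using lim(1) vp by (rule order_tendstoD)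
    then show thesis using that by (metis diff_gt_0_iff_gt eventually_happens trivial_limit_at_bot_linorder)
  qed
  ultimately have "vp - V \<xi> > 0" by (rule linear_homogeneous_positive)
  then show "V \<xi> < vp" by simp
qed

lemma profile_travelling_wave:
  assumes \<epsilon>: "\<epsilon> > 0" and \<gamma>: "\<gamma> \<ge> 1" and s: "s \<noteq> 0"
    and V1: "\<And>\<xi>. V \<xi> > 1"
    and V: "\<And>\<xi>. (V has_real_derivative profile_rhs \<epsilon> \<gamma> s vp (V \<xi>)) (at \<xi>)"
  shows "travelling_wave \<epsilon> \<gamma> s (\<lambda>\<xi>. k - s * V \<xi>) V"
proof -
  define V' where "V' \<xi> = profile_rhs \<epsilon> \<gamma> s vp (V \<xi>)" for \<xi>
  have V_d: "(V has_real_derivative V' \<xi>) (at \<xi>)" for \<xi> using V by (simp add: V'_def)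
  have flux: "phi \<epsilon> \<gamma> (V y) * (- s * V' y) = - s * (s * (vp - V y))" for y
    unfolding phi_times_profile_rhs[OF \<epsilon> \<gamma> V1, of y s vp, symmetric] V'_def by (simp only: mult_ac)
  have "((\<lambda>\<xi>. k - s * V \<xi>) has_real_derivative - s * V' \<xi>) (at \<xi>)"
    "((\<lambda>y. phi \<epsilon> \<gamma> (V y) * (- s * V' y)) has_real_derivative s\<^sup>2 * V' \<xi>) (at \<xi>)" for \<xi>
    unfolding flux using V_d by (auto intro!: derivative_eq_intros simp: power2_eq_square)
  then show ?thesis unfolding travelling_wave_iff[OF s] using V1 V_d by blast
qed

section \<open>Existence of the profile\<close>

text \<open>
  Since \<open>\<gamma> \<ge> 1\<close>, the factor \<open>(v - 1)^(\<gamma>+1)\<close> splits into \<open>(v - 1)^\<gamma>\<close>, which is bounded on \<open>(1, vp)\<close>,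
  and the linear factor that the comparison with the logistic equation asks for.
\<close>
lemma profile_exists:
  assumes \<epsilon>: "\<epsilon> > 0" and \<gamma>: "\<gamma> \<ge> 1" and s: "s > 0" and vp: "1 < vp"
  shows "\<exists>V. V 0 = (1 + vp) / 2 \<and>
    (\<forall>\<xi>. 1 < V \<xi> \<and> V \<xi> < vp \<and> (V has_real_derivative profile_rhs \<epsilon> \<gamma> s vp (V \<xi>)) (at \<xi>)) \<and>
    strict_mono V \<and> (V \<longlongrightarrow> 1) at_bot \<and> (V \<longlongrightarrow> vp) at_top \<and>
    (\<forall>W. (\<forall>\<xi>. 1 < W \<xi> \<and> W \<xi> < vp \<and>
        (W has_real_derivative profile_rhs \<epsilon> \<gamma> s vp (W \<xi>)) (at \<xi>)) \<longrightarrow>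
      (\<exists>h. \<forall>\<xi>. W \<xi> = V (\<xi> + h)))"
proof (rule heteroclinic_orbit[where C = "s / (\<epsilon> * \<gamma>) * vp * (vp - 1) powr \<gamma>"])
  show "1 < (1 + vp) / 2" "(1 + vp) / 2 < vp" using vp by auto
next
  fix v assume v: "1 < v" "v < vp"
  then show "isCont (profile_rhs \<epsilon> \<gamma> s vp) v"
    unfolding profile_rhs_def[abs_def] by (intro continuous_intros) auto
  show "0 < profile_rhs \<epsilon> \<gamma> s vp v" unfolding profile_rhs_def using v \<epsilon> \<gamma> s by simp
  have "v * (v - 1) powr \<gamma> \<le> vp * (vp - 1) powr \<gamma>"
    using v \<gamma> by (intro mult_mono powr_mono2) auto
  then have "s / (\<epsilon> * \<gamma>) * ((v - 1) * (vp - v)) * (v * (v - 1) powr \<gamma>)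
      \<le> s / (\<epsilon> * \<gamma>) * ((v - 1) * (vp - v)) * (vp * (vp - 1) powr \<gamma>)"
    using v \<epsilon> \<gamma> s by (intro mult_left_mono) auto
  moreover have "(v - 1) powr (\<gamma> + 1) = (v - 1) powr \<gamma> * (v - 1)"
    using v by (simp add: powr_add)
  ultimately show "profile_rhs \<epsilon> \<gamma> s vp v
      \<le> s / (\<epsilon> * \<gamma>) * vp * (vp - 1) powr \<gamma> * (v - 1) * (vp - v)"
    unfolding profile_rhs_def by (simp only: mult_ac)
qed

section \<open>Estimates in the congested and in the free region\<close>

text \<open>
  A profile on the left half-line takes values in \<open>(1, (1 + vp) / 2]\<close>, where \<open>V (vp - V)\<close> lies
  between \<open>(vp - 1) / 2\<close> and \<open>(vp - 1) (vp + 1) / 2\<close>.  Hence \<open>(V - 1)^(-\<gamma>)\<close>, whose derivative is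
  \<open>- s / \<epsilon>\<close> times this quantity, lies between two affine functions with the value \<open>B\<close> at \<open>0\<close>.
\<close>
lemma congested_estimate:
  assumes \<epsilon>: "\<epsilon> > 0" and \<gamma>: "\<gamma> \<ge> 1" and s: "s > 0"
    and V0: "V 0 = (1 + vp) / 2" and V1: "\<And>\<xi>. 1 < V \<xi>" and Vp: "\<And>\<xi>. V \<xi> < vp"
    and V: "\<And>\<xi>. (V has_real_derivative profile_rhs \<epsilon> \<gamma> s vp (V \<xi>)) (at \<xi>)"
    and mono: "strict_mono V" and \<xi>: "\<xi> < 0"
  defines "B \<equiv> (2 / (vp - 1)) powr \<gamma>"
  shows "1 + (B - s * (vp - 1) * (vp + 1) / 2 / \<epsilon> * \<xi>) powr (- 1 / \<gamma>) \<le> V \<xi>"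
    and "V \<xi> \<le> 1 + (B - s * (vp - 1) / 2 / \<epsilon> * \<xi>) powr (- 1 / \<gamma>)"
proof -
  have vp: "1 < vp" using V1[of 0] Vp[of 0] by linarith
  define y where "y \<xi> = (V \<xi> - 1) powr (- \<gamma>)" for \<xi>
  have y: "(y has_real_derivative - (s / \<epsilon>) * (V \<xi> * (vp - V \<xi>))) (at \<xi>)" for \<xi>
  proof -
    have "(V \<xi> - 1) powr (- \<gamma> - 1) * (V \<xi> - 1) powr (\<gamma> + 1) = 1"
      using V1[of \<xi>] by (simp add: powr_add[symmetric])
    moreover have "(y has_real_derivative
        - \<gamma> * (V \<xi> - 1) powr (- \<gamma> - 1) * profile_rhs \<epsilon> \<gamma> s vp (V \<xi>)) (at \<xi>)"
      unfolding y_def using V1[of \<xi>] V[of \<xi>] by (auto intro!: derivative_eq_intros)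
    moreover have "- \<gamma> * p * profile_rhs \<epsilon> \<gamma> s vp (V \<xi>)
        = - (s / \<epsilon>) * (V \<xi> * (vp - V \<xi>)) * (p * (V \<xi> - 1) powr (\<gamma> + 1))" for p
      unfolding profile_rhs_def using \<epsilon> \<gamma> by (simp add: field_simps)
    ultimately show ?thesis by (metis mult.right_neutral)
  qed
  have y0: "y 0 = B"
  proof -
    have "V 0 - 1 = (vp - 1) / 2" by (simp add: V0 field_simps)
    then show ?thesis unfolding y_def B_def using vp by (simp only: powr_minus) (simp add: powr_divide)
  qed
  have B: "B > 0" unfolding B_def using vp by simp
  have range: "(vp - 1) / 2 \<le> V x * (vp - V x)" "V x * (vp - V x) \<le> (vp - 1) * (vp + 1) / 2"
    if "x \<le> 0" for x
  proof -
    have le: "V x \<le> (1 + vp) / 2" using mono that V0 by (metis strict_mono_less_eq)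
    have "1 * ((vp - 1) / 2) \<le> V x * (vp - V x)"
      using le V1[of x] vp by (intro mult_mono) auto
    then show "(vp - 1) / 2 \<le> V x * (vp - V x)" by simp
    have "V x * (vp - V x) \<le> (1 + vp) / 2 * (vp - 1)"
      using le V1[of x] Vp[of x] vp by (intro mult_mono) auto
    then show "V x * (vp - V x) \<le> (vp - 1) * (vp + 1) / 2" by (simp add: algebra_simps)
  qed
  have upper: "y \<xi> \<le> B - s * (vp - 1) * (vp + 1) / 2 / \<epsilon> * \<xi>"
  proof -
    have "y \<xi> + s / \<epsilon> * ((vp - 1) * (vp + 1) / 2) * \<xi>
        \<le> y 0 + s / \<epsilon> * ((vp - 1) * (vp + 1) / 2) * 0"
    proof (rule DERIV_nonneg_imp_nondecreasing[of \<xi> 0])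
      fix x assume x: "\<xi> \<le> x" "x \<le> 0"
      have "((\<lambda>x. y x + s / \<epsilon> * ((vp - 1) * (vp + 1) / 2) * x) has_real_derivative
          - (s / \<epsilon>) * (V x * (vp - V x)) + s / \<epsilon> * ((vp - 1) * (vp + 1) / 2)) (at x)"
        by (intro DERIV_add y DERIV_cmult_Id)
      moreover have "0 \<le> - (s / \<epsilon>) * (V x * (vp - V x)) + s / \<epsilon> * ((vp - 1) * (vp + 1) / 2)"
        using mult_left_mono[OF range(2)[OF x(2)], of "s / \<epsilon>"] s \<epsilon> by simp
      ultimately show "\<exists>d. ((\<lambda>x. y x + s / \<epsilon> * ((vp - 1) * (vp + 1) / 2) * x)
          has_real_derivative d) (at x) \<and> 0 \<le> d"
        by blast
    qed (use \<xi> in auto)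
    then show ?thesis by (simp add: y0 mult.assoc)
  qed
  have lower: "B - s * (vp - 1) / 2 / \<epsilon> * \<xi> \<le> y \<xi>"
  proof -
    have "y \<xi> + s / \<epsilon> * ((vp - 1) / 2) * \<xi> \<ge> y 0 + s / \<epsilon> * ((vp - 1) / 2) * 0"
    proof (rule DERIV_nonpos_imp_nonincreasing[of \<xi> 0])
      fix x assume x: "\<xi> \<le> x" "x \<le> 0"
      have "((\<lambda>x. y x + s / \<epsilon> * ((vp - 1) / 2) * x) has_real_derivative
          - (s / \<epsilon>) * (V x * (vp - V x)) + s / \<epsilon> * ((vp - 1) / 2)) (at x)"
        by (intro DERIV_add y DERIV_cmult_Id)
      moreover have "- (s / \<epsilon>) * (V x * (vp - V x)) + s / \<epsilon> * ((vp - 1) / 2) \<le> 0"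
        using mult_left_mono[OF range(1)[OF x(2)], of "s / \<epsilon>"] s \<epsilon> by simp
      ultimately show "\<exists>d. ((\<lambda>x. y x + s / \<epsilon> * ((vp - 1) / 2) * x) has_real_derivative d) (at x) \<and> d \<le> 0"
        by blast
    qed (use \<xi> in auto)
    then show ?thesis by (simp add: y0 mult.assoc)
  qed
  have V_y: "V \<xi> = 1 + y \<xi> powr (- 1 / \<gamma>)"
    unfolding y_def using V1[of \<xi>] \<gamma> by (simp add: powr_powr)
  have y_pos: "y \<xi> > 0" unfolding y_def using V1[of \<xi>] by simp
  show "1 + (B - s * (vp - 1) * (vp + 1) / 2 / \<epsilon> * \<xi>) powr (- 1 / \<gamma>) \<le> V \<xi>"
    unfolding V_y using upper y_pos \<gamma> by (intro add_left_mono powr_mono2') auto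
  have "s * (vp - 1) / 2 / \<epsilon> * \<xi> \<le> 0"
    using s \<epsilon> vp \<xi> by (intro mult_nonneg_nonpos) auto
  then show "V \<xi> \<le> 1 + (B - s * (vp - 1) / 2 / \<epsilon> * \<xi>) powr (- 1 / \<gamma>)"
    unfolding V_y using lower B \<gamma> by (intro add_left_mono powr_mono2') auto
qed

text \<open>
  On the right half-line \<open>V\<close> takes values in \<open>[(1 + vp) / 2, vp)\<close>, so the exponential decay rate
  \<open>s V (V - 1)^(\<gamma>+1) / (\<epsilon> \<gamma>)\<close> of \<open>vp - V\<close>, which increases with \<open>V\<close>, lies between its values at the
  two end points, \<open>A2 / \<epsilon>\<close> and \<open>A3 / \<epsilon>\<close>.
\<close>
lemma free_estimate:
  assumes \<epsilon>: "\<epsilon> > 0" and \<gamma>: "\<gamma> \<ge> 1" and s: "s > 0"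
    and V0: "V 0 = (1 + vp) / 2" and V1: "\<And>\<xi>. 1 < V \<xi>" and Vp: "\<And>\<xi>. V \<xi> < vp"
    and V: "\<And>\<xi>. (V has_real_derivative profile_rhs \<epsilon> \<gamma> s vp (V \<xi>)) (at \<xi>)"
    and mono: "strict_mono V" and \<xi>: "\<xi> > 0"
  defines "A2 \<equiv> s * (vp + 1) * (vp - 1) powr (\<gamma> + 1) / (2 powr (\<gamma> + 2) * \<gamma>)"
    and "A3 \<equiv> s * vp * (vp - 1) powr (\<gamma> + 1) / \<gamma>"
  shows "vp - (vp - 1) / 2 * exp (- (A2 / \<epsilon>) * \<xi>) \<le> V \<xi>"
    and "V \<xi> \<le> vp - (vp - 1) / 2 * exp (- (A3 / \<epsilon>) * \<xi>)"
proof -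
  have vp: "1 < vp" using V1[of 0] Vp[of 0] by linarith
  define g where "g x = s / (\<epsilon> * \<gamma>) * (V x * (V x - 1) powr (\<gamma> + 1))" for x
  define W where "W x = ln (vp - V x)" for x
  have W: "(W has_real_derivative - g x) (at x)" for x
  proof -
    have "(W has_real_derivative - profile_rhs \<epsilon> \<gamma> s vp (V x) / (vp - V x)) (at x)"
      unfolding W_def using Vp[of x] V[of x] by (auto intro!: derivative_eq_intros)
    moreover have "profile_rhs \<epsilon> \<gamma> s vp (V x) / (vp - V x) = g x"
      unfolding profile_rhs_def g_def using Vp[of x] by simp
    ultimately show ?thesis by simp
  qed
  have W0: "exp (W 0) = (vp - 1) / 2" unfolding W_def V0 using vp by (simp add: field_simps)
  have expW: "exp (W \<xi>) = vp - V \<xi>" unfolding W_def using Vp[of \<xi>] by simp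
  have A2: "A2 / \<epsilon> = s / (\<epsilon> * \<gamma>) * ((1 + vp) / 2 * ((vp - 1) / 2) powr (\<gamma> + 1))"
  proof -
    have "(2::real) powr (\<gamma> + 2) = 2 powr (\<gamma> + 1) * 2"
      using powr_add[of 2 "\<gamma> + 1" 1] by (simp add: add.commute)
    then show ?thesis unfolding A2_def using vp by (simp add: powr_divide field_simps)
  qed
  have A3: "A3 / \<epsilon> = s / (\<epsilon> * \<gamma>) * (vp * (vp - 1) powr (\<gamma> + 1))"
    unfolding A3_def by (simp add: field_simps)
  have g: "A2 / \<epsilon> \<le> g x" "g x \<le> A3 / \<epsilon>" if "0 \<le> x" for x
  proof -
    have ge: "(1 + vp) / 2 \<le> V x" using mono that V0 by (metis strict_mono_less_eq)
    have "(1 + vp) / 2 * ((vp - 1) / 2) powr (\<gamma> + 1) \<le> V x * (V x - 1) powr (\<gamma> + 1)"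
      using ge V1[of x] vp \<gamma> by (intro mult_mono powr_mono2) (auto simp: field_simps)
    then show "A2 / \<epsilon> \<le> g x"
      unfolding A2 g_def using s \<epsilon> \<gamma> by (intro mult_left_mono) auto
    have "V x * (V x - 1) powr (\<gamma> + 1) \<le> vp * (vp - 1) powr (\<gamma> + 1)"
      using V1[of x] Vp[of x] \<gamma> by (intro mult_mono powr_mono2) auto
    then show "g x \<le> A3 / \<epsilon>"
      unfolding A3 g_def using s \<epsilon> \<gamma> by (intro mult_left_mono) auto
  qed
  have "W \<xi> + A2 / \<epsilon> * \<xi> \<le> W 0 + A2 / \<epsilon> * 0"
  proof (rule DERIV_nonpos_imp_nonincreasing[of 0 \<xi>])
    fix x assume x: "0 \<le> x" "x \<le> \<xi>"
    have "((\<lambda>x. W x + A2 / \<epsilon> * x) has_real_derivative - g x + A2 / \<epsilon>) (at x)"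
      by (intro DERIV_add W DERIV_cmult_Id)
    then show "\<exists>d. ((\<lambda>x. W x + A2 / \<epsilon> * x) has_real_derivative d) (at x) \<and> d \<le> 0"
      using g(1)[OF x(1)] by (intro exI[of _ "- g x + A2 / \<epsilon>"]) simp
  qed (use \<xi> in auto)
  then have "exp (W \<xi>) \<le> exp (W 0 + - (A2 / \<epsilon>) * \<xi>)" by simp
  then show "vp - (vp - 1) / 2 * exp (- (A2 / \<epsilon>) * \<xi>) \<le> V \<xi>"
    unfolding exp_add W0 expW by simp
  have "W \<xi> + A3 / \<epsilon> * \<xi> \<ge> W 0 + A3 / \<epsilon> * 0"
  proof (rule DERIV_nonneg_imp_nondecreasing[of 0 \<xi>])
    fix x assume x: "0 \<le> x" "x \<le> \<xi>"
    have "((\<lambda>x. W x + A3 / \<epsilon> * x) has_real_derivative - g x + A3 / \<epsilon>) (at x)"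
      by (intro DERIV_add W DERIV_cmult_Id)
    then show "\<exists>d. ((\<lambda>x. W x + A3 / \<epsilon> * x) has_real_derivative d) (at x) \<and> 0 \<le> d"
      using g(2)[OF x(1)] by (intro exI[of _ "- g x + A3 / \<epsilon>"]) simp
  qed (use \<xi> in auto)
  then have "exp (W 0 + - (A3 / \<epsilon>) * \<xi>) \<le> exp (W \<xi>)" by simp
  then show "V \<xi> \<le> vp - (vp - 1) / 2 * exp (- (A3 / \<epsilon>) * \<xi>)"
    unfolding exp_add W0 expW by simp
qed

section \<open>The vanishing viscosity limit and the main result\<close>

lemma filterlim_divide_at_right_0:
  "0 < c \<Longrightarrow> filterlim (\<lambda>\<epsilon>::real. c / \<epsilon>) at_top (at_right 0)"
  unfolding divide_inverse
  by (intro filterlim_tendsto_pos_mult_at_top[OF tendsto_const] filterlim_inverse_at_top_right) auto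

lemma congested_bound_tendsto:
  fixes \<gamma> A B \<xi> :: real
  assumes "\<gamma> \<ge> 1" "A > 0" "\<xi> < 0"
  shows "((\<lambda>\<epsilon>. 1 + (B - A / \<epsilon> * \<xi>) powr (- 1 / \<gamma>)) \<longlongrightarrow> 1) (at_right 0)"
proof -
  have "filterlim (\<lambda>\<epsilon>. B + (A * - \<xi>) / \<epsilon>) at_top (at_right 0)"
    using assms by (intro filterlim_tendsto_add_at_top[OF tendsto_const]
        filterlim_divide_at_right_0 mult_pos_pos) auto
  then have "((\<lambda>\<epsilon>. (B + (A * - \<xi>) / \<epsilon>) powr (- 1 / \<gamma>)) \<longlongrightarrow> 0) (at_right 0)"
    using assms by (intro tendsto_neg_powr) auto
  from tendsto_add[OF tendsto_const[of 1] this] show ?thesis by simp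
qed

lemma free_bound_tendsto:
  fixes A C b \<xi> :: real
  assumes "A > 0" "\<xi> > 0"
  shows "((\<lambda>\<epsilon>. b - C * exp (- (A / \<epsilon>) * \<xi>)) \<longlongrightarrow> b) (at_right 0)"
proof -
  have "filterlim (\<lambda>\<epsilon>. - ((A * \<xi>) / \<epsilon>)) at_bot (at_right 0)"
    unfolding filterlim_uminus_at_top[symmetric] using assms by (intro filterlim_divide_at_right_0) auto
  then have "((\<lambda>\<epsilon>. exp (- ((A * \<xi>) / \<epsilon>))) \<longlongrightarrow> 0) (at_right 0)"
    by (rule filterlim_compose[OF exp_at_bot])
  from tendsto_diff[OF tendsto_const[of b] tendsto_mult[OF tendsto_const[of C] this]]
  show ?thesis by simp
qed

theorem proposition1p2:
  fixes \<gamma> um up vm vp s A0 A1 A2 A3 B :: real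
  assumes "\<gamma> \<ge> 1" and "1 = vm" and "vm < vp" and "um > up"
  defines "s \<equiv> (um - up) / (vp - 1)"
  defines "A0 \<equiv> s * (vp - 1) * (vp + 1) / 2"
    and "A1 \<equiv> s * (vp - 1) / 2"
    and "A2 \<equiv> s * (vp + 1) * (vp - 1) powr (\<gamma> + 1) / (2 powr (\<gamma> + 2) * \<gamma>)"
    and "A3 \<equiv> s * vp * (vp - 1) powr (\<gamma> + 1) / \<gamma>"
    and "B \<equiv> (2 / (vp - 1)) powr \<gamma>"
  shows "\<exists>U V :: real \<Rightarrow> real \<Rightarrow> real.
    (\<forall>\<epsilon>>0.
      travelling_wave \<epsilon> \<gamma> s (U \<epsilon>) (V \<epsilon>) \<and> far_field (U \<epsilon>) (V \<epsilon>) um vm up vp \<and>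
      (\<forall>s' u v. travelling_wave \<epsilon> \<gamma> s' u v \<and> far_field u v um vm up vp \<longrightarrow>
         s' = s \<and> (\<exists>h. \<forall>\<xi>. u \<xi> = U \<epsilon> (\<xi> + h) \<and> v \<xi> = V \<epsilon> (\<xi> + h))) \<and>
      smooth (V \<epsilon>) \<and> strict_mono (V \<epsilon>) \<and>
      V \<epsilon> 0 = (1 + vp) / 2 \<and>
      (\<forall>\<xi><0. 1 + (B - A0 / \<epsilon> * \<xi>) powr (- 1 / \<gamma>) \<le> V \<epsilon> \<xi> \<and>
              V \<epsilon> \<xi> \<le> 1 + (B - A1 / \<epsilon> * \<xi>) powr (- 1 / \<gamma>)) \<and>
      (\<forall>\<xi>>0. vp - (vp - 1) / 2 * exp (- (A2 / \<epsilon>) * \<xi>) \<le> V \<epsilon> \<xi> \<and>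
              V \<epsilon> \<xi> \<le> vp - (vp - 1) / 2 * exp (- (A3 / \<epsilon>) * \<xi>)) \<and>
      (\<forall>\<xi>. V \<epsilon> \<xi> \<le> (1 + (B - A1 / \<epsilon> * \<xi>) powr (- 1 / \<gamma>)) * indicator {..<0} \<xi>
                     + vp * indicator {0..} \<xi>)) \<and>
    (\<forall>\<xi>. \<xi> \<noteq> 0 \<longrightarrow> ((\<lambda>\<epsilon>. V \<epsilon> \<xi>) \<longlongrightarrow> shock_wave vp \<xi>) (at_right 0))"
proof -
  have vm1: "vm = 1" and vp: "1 < vp" using assms(2,3) by auto
  have s: "s > 0" unfolding s_def using vp assms(4) by simp
  have A_pos: "A0 > 0" "A1 > 0" "A2 > 0" "A3 > 0"
    unfolding A0_def A1_def A2_def A3_def using s vp assms(1) by simp_all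
  define profile where "profile \<epsilon> W \<longleftrightarrow>
      travelling_wave \<epsilon> \<gamma> s (\<lambda>\<xi>. um + s - s * W \<xi>) W \<and>
      far_field (\<lambda>\<xi>. um + s - s * W \<xi>) W um vm up vp \<and>
      (\<forall>s' u v. travelling_wave \<epsilon> \<gamma> s' u v \<and> far_field u v um vm up vp \<longrightarrow>
         s' = s \<and> (\<exists>h. \<forall>\<xi>. u \<xi> = um + s - s * W (\<xi> + h) \<and> v \<xi> = W (\<xi> + h))) \<and>
      smooth W \<and> strict_mono W \<and>
      W 0 = (1 + vp) / 2 \<and>
      (\<forall>\<xi><0. 1 + (B - A0 / \<epsilon> * \<xi>) powr (- 1 / \<gamma>) \<le> W \<xi> \<and>
              W \<xi> \<le> 1 + (B - A1 / \<epsilon> * \<xi>) powr (- 1 / \<gamma>)) \<and>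
      (\<forall>\<xi>>0. vp - (vp - 1) / 2 * exp (- (A2 / \<epsilon>) * \<xi>) \<le> W \<xi> \<and>
              W \<xi> \<le> vp - (vp - 1) / 2 * exp (- (A3 / \<epsilon>) * \<xi>)) \<and>
      (\<forall>\<xi>. W \<xi> \<le> (1 + (B - A1 / \<epsilon> * \<xi>) powr (- 1 / \<gamma>)) * indicator {..<0} \<xi>
                     + vp * indicator {0..} \<xi>)" for \<epsilon> W
  have "\<exists>W. profile \<epsilon> W" if \<epsilon>: "\<epsilon> > 0" for \<epsilon>
  proof -
    obtain V where V0: "V 0 = (1 + vp) / 2" and V1: "\<And>\<xi>. 1 < V \<xi>" and Vp: "\<And>\<xi>. V \<xi> < vp"
      and V: "\<And>\<xi>. (V has_real_derivative profile_rhs \<epsilon> \<gamma> s vp (V \<xi>)) (at \<xi>)"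
      and mono: "strict_mono V"
      and lim: "(V \<longlongrightarrow> 1) at_bot" "(V \<longlongrightarrow> vp) at_top"
      and uniq: "\<forall>W. (\<forall>\<xi>. 1 < W \<xi> \<and> W \<xi> < vp \<and>
          (W has_real_derivative profile_rhs \<epsilon> \<gamma> s vp (W \<xi>)) (at \<xi>)) \<longrightarrow>
        (\<exists>h. \<forall>\<xi>. W \<xi> = V (\<xi> + h))"
      using profile_exists[OF \<epsilon> assms(1) s vp] by blast
    have tw: "travelling_wave \<epsilon> \<gamma> s (\<lambda>\<xi>. um + s - s * V \<xi>) V"
      using s by (intro profile_travelling_wave[OF \<epsilon> assms(1) _ V1 V]) simp
    have "s * (vp - 1) = um - up" using vp by (simp add: s_def)
    then have "um + s - s * vp = up" by (simp add: algebra_simps)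
    moreover have "((\<lambda>\<xi>. um + s - s * V \<xi>) \<longlongrightarrow> um + s - s * 1) at_bot"
      "((\<lambda>\<xi>. um + s - s * V \<xi>) \<longlongrightarrow> um + s - s * vp) at_top"
      by (intro tendsto_intros lim)+
    ultimately have ff: "far_field (\<lambda>\<xi>. um + s - s * V \<xi>) V um vm up vp"
      unfolding far_field_def vm1 using lim by simp
    have unique: "s' = s \<and> (\<exists>h. \<forall>\<xi>. u \<xi> = um + s - s * V (\<xi> + h) \<and> v \<xi> = V (\<xi> + h))"
      if tw': "travelling_wave \<epsilon> \<gamma> s' u v" and ff': "far_field u v um vm up vp" for s' u v
    proof -
      note ff1 = ff'[unfolded vm1]
      have s': "s' = s" using travelling_wave_speed(1)[OF vp assms(4) tw' ff1] by (simp add: s_def)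
      have "\<exists>h. \<forall>\<xi>. v \<xi> = V (\<xi> + h)"
        using travelling_wave_profile[OF \<epsilon> assms(1) vp assms(4) tw' ff1] s'
        by (intro uniq[rule_format]) auto
      then show ?thesis
        using travelling_wave_speed(2)[OF vp assms(4) tw' ff1] s' by auto
    qed
    have "powr_polynomial (profile_rhs \<epsilon> \<gamma> s vp)"
    proof -
      have "powr_polynomial
          (\<lambda>v. s / (\<epsilon> * \<gamma>) * v * (v - 1) powr (\<gamma> + 1) * (vp + (- 1) * v))"
        by (intro powr_polynomial.intros)
      then show ?thesis by (simp add: profile_rhs_def[abs_def])
    qed
    then have smooth: "smooth V" using V1 V by (rule smooth_autonomous_solution)
    have congested: "1 + (B - A0 / \<epsilon> * \<xi>) powr (- 1 / \<gamma>) \<le> V \<xi> \<and>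
        V \<xi> \<le> 1 + (B - A1 / \<epsilon> * \<xi>) powr (- 1 / \<gamma>)" if "\<xi> < 0" for \<xi>
      unfolding A0_def A1_def B_def
      using congested_estimate[OF \<epsilon> assms(1) s V0 V1 Vp V mono that] by blast
    have free: "vp - (vp - 1) / 2 * exp (- (A2 / \<epsilon>) * \<xi>) \<le> V \<xi> \<and>
        V \<xi> \<le> vp - (vp - 1) / 2 * exp (- (A3 / \<epsilon>) * \<xi>)" if "\<xi> > 0" for \<xi>
      unfolding A2_def A3_def
      using free_estimate[OF \<epsilon> assms(1) s V0 V1 Vp V mono that] by blast
    have bound: "V \<xi> \<le> (1 + (B - A1 / \<epsilon> * \<xi>) powr (- 1 / \<gamma>)) * indicator {..<0} \<xi>
        + vp * indicator {0..} \<xi>" for \<xi>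
      using congested[of \<xi>] Vp[of \<xi>] by (cases "\<xi> < 0") auto
    have "profile \<epsilon> V"
      unfolding profile_def
      using tw ff unique smooth mono V0 congested free bound by (intro conjI allI impI) blast+
    then show ?thesis by blast
  qed
  then obtain V where V: "\<forall>\<epsilon>>0. profile \<epsilon> (V \<epsilon>)" by metis
  have estimates:
    "\<xi> < 0 \<Longrightarrow> 1 + (B - A0 / \<epsilon> * \<xi>) powr (- 1 / \<gamma>) \<le> V \<epsilon> \<xi>"
    "\<xi> < 0 \<Longrightarrow> V \<epsilon> \<xi> \<le> 1 + (B - A1 / \<epsilon> * \<xi>) powr (- 1 / \<gamma>)"
    "\<xi> > 0 \<Longrightarrow> vp - (vp - 1) / 2 * exp (- (A2 / \<epsilon>) * \<xi>) \<le> V \<epsilon> \<xi>"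
    "\<xi> > 0 \<Longrightarrow> V \<epsilon> \<xi> \<le> vp - (vp - 1) / 2 * exp (- (A3 / \<epsilon>) * \<xi>)"
    if "\<epsilon> > 0" for \<epsilon> \<xi>
    using V that unfolding profile_def by blast+
  have \<epsilon>_pos: "\<forall>\<^sub>F \<epsilon> in at_right 0. \<epsilon> > (0::real)" by (rule eventually_at_right_less)
  have limit: "((\<lambda>\<epsilon>. V \<epsilon> \<xi>) \<longlongrightarrow> shock_wave vp \<xi>) (at_right 0)" if "\<xi> \<noteq> 0" for \<xi>
  proof (cases "\<xi> < 0")
    case True
    have "((\<lambda>\<epsilon>. V \<epsilon> \<xi>) \<longlongrightarrow> 1) (at_right 0)"
      by (rule tendsto_sandwich[OF _ _ congested_bound_tendsto[OF assms(1) A_pos(1) True]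
            congested_bound_tendsto[OF assms(1) A_pos(2) True]])
        (rule eventually_mono[OF \<epsilon>_pos], erule estimates, rule True)+
    then show ?thesis using True by (simp add: shock_wave_def)
  next
    case False
    then have \<xi>: "\<xi> > 0" using that by simp
    have "((\<lambda>\<epsilon>. V \<epsilon> \<xi>) \<longlongrightarrow> vp) (at_right 0)"
      by (rule tendsto_sandwich[OF _ _ free_bound_tendsto[OF A_pos(3) \<xi>]
            free_bound_tendsto[OF A_pos(4) \<xi>]])
        (rule eventually_mono[OF \<epsilon>_pos], erule estimates, rule \<xi>)+
    then show ?thesis using \<xi> by (simp add: shock_wave_def)
  qed
  then have "\<forall>\<xi>. \<xi> \<noteq> 0 \<longrightarrow> ((\<lambda>\<epsilon>. V \<epsilon> \<xi>) \<longlongrightarrow> shock_wave vp \<xi>) (at_right 0)" by blast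
  from conjI[OF V[unfolded profile_def] this] show ?thesis
    by (intro exI[of _ "\<lambda>\<epsilon> \<xi>. um + s - s * V \<epsilon> \<xi>"] exI[of _ V])
qed

end
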